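(* With all data as defined in the context, suppose $\mathcal{F}$ is nonempty. Then, for every $\epsilon>0$, there exists $T^*>0$ such that, for every integer $T\ge T^*$ and every policy $\eta\in\mathcal{F}^+_T$ that is a solution to the problem $(P_T^+):\ \min_{\pi\in\mathcal{F}^+_T}J^\pi_{\gamma,R,T}(x)$, the policy $\eta$ is $\epsilon$-feasible for the problem $(P):\ \min_{\pi\in\mathcal{F}}J^\pi_{\gamma,R}(x)$ and satisfies $$\Big|J^\eta_{\gamma,R}(x)-\inf_{\pi\in\mathcal{F}}J^\pi_{\gamma,R}(x)\Big|<\epsilon.$$
   Context: **MDP.** $\mathcal{S}=\{s_1,\dots,s_m\}$ and $\mathcal{A}=\{a_1,\dots,a_n\}$ are finite sets of states and actions; $p(s'|s,a)$ is a (time-homogeneous) transition probability from $s$ to $s'$ under action $a$. A Markovian randomized (MR) decision rule $d$ assigns to each state $s$ a probability distribution $d(\cdot|s)$ on $\mathcal{A}$. An MR policy is a sequence $\pi=\{d_t\}_{t=0}^\infty$ of MR decision rules; $\Pi_{\rm MR}$ is the set of all MR policies. For $x\in\mathcal{S}$, $\mathbb{E}^\pi_x$ denotes expectation for the process $(X_t,A_t)_{t\ge0}$ with $X_0=x$, $A_t\sim d_t(\cdot|X_t)$, $X_{t+1}\sim p(\cdot|X_t,A_t)$. **Costs.** Fix a discount factor $\beta\in(0,1)$ and a risk factor $\gamma\in\mathbb{R}\setminus\{0\}$. For an immediate cost function $R:\mathcal{S}\times\mathcal{A}\to\mathbb{R}$, $x\in\mathcal S$ and integer $T\ge1$, $$J^{\pi}_{\gamma,R}(x)=\mathbb{E}^\pi_x\Big[e^{\gamma\sum_{t=0}^{\infty}\beta^tR(X_t,A_t)}\Big],\quad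 J^{\pi}_{\gamma,R,T}(x)=\mathbb{E}^\pi_x\Big[e^{\gamma\sum_{t=0}^{T-1}\beta^tR(X_t,A_t)}\Big],$$ $$v^{\pi}_{R}(x)=\mathbb{E}^\pi_x\Big[\sum_{t=0}^{\infty}\beta^tR(X_t,A_t)\Big],\quad v^{\pi}_{R,T}(x)=\mathbb{E}^\pi_x\Big[\sum_{t=0}^{T-1}\beta^tR(X_t,A_t)\Big].$$ **Constraints.** Fix the initial state $x\in\mathcal{S}$, an objective immediate cost $R$, nonnegative integers $M,\hat M,\bar M,\check M$, at least one nonzero, immediate cost functions $C_i,\hat C_j,\bar C_k,\check C_l:\mathcal{S}\times\mathcal{A}\to\mathbb{R}$, real constants $b_i,\hat b_j,\bar b_k,\check b_l$ and finite horizons (positive integers) $\bar T_k,\check T_l$, where $1\le i\le M$, $1\le j\le\hat M$, $1\le k\le\bar M$, $1\le l\le\check M$. Let $C>0$ be a common bound on the absolute values of all these immediate cost functions (including $R$), $K=C/(1-\beta)$, and $K_T=e^{|\gamma|K\beta^T}$. Define subsets of $\Pi_{\rm MR}$: - $\mathcal{C}=\{\pi: v^\pi_{C_i}(x)\le b_i\ \forall i\}$, $\hat{\mathcal{C}}=\{\pi: J^\pi_{\gamma,\hat C_j}(x)\le\hat b_j\ \forall j\}$, - $\bar{\mathcal{C}}=\{\pi: v^\pi_{\bar C_k,\bar T_k}(x)\le\bar b_k\ \forall k\}$, $\check{\mathcal{C}}=\{\pi: J^\pi_{\gamma,\check C_l,\check T_l}(x)\le\check b_l\ \forall l\}$, -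 $\mathcal{C}^+_T=\{\pi: v^\pi_{C_i,T}(x)\le b_i+K\beta^T\ \forall i\}$, $\hat{\mathcal{C}}^+_T=\{\pi: J^\pi_{\gamma,\hat C_j,T}(x)\le\hat b_jK_T\ \forall j\}$. Set $\mathcal{F}=\mathcal{C}\cap\hat{\mathcal{C}}\cap\bar{\mathcal{C}}\cap\check{\mathcal{C}}$ and $\mathcal{F}^+_T=\mathcal{C}^+_T\cap\hat{\mathcal{C}}^+_T\cap\bar{\mathcal{C}}\cap\check{\mathcal{C}}$. **$\epsilon$-feasibility.** For $\epsilon>0$, a policy $\pi\in\Pi_{\rm MR}$ is $\epsilon$-feasible for $(P)$ if $v^\pi_{C_i}(x)\le b_i+\epsilon$, $J^\pi_{\gamma,\hat C_j}(x)\le\hat b_j+\epsilon$, $v^\pi_{\bar C_k,\bar T_k}(x)\le\bar b_k+\epsilon$ and $J^\pi_{\gamma,\check C_l,\check T_l}(x)\le\check b_l+\epsilon$ for all $1\le i\le M$, $1\le j\le\hat M$, $1\le k\le\bar M$, $1\le l\le\check M$. *)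

theory Defs
  imports "HOL-Probability.Probability"
begin

text \<open>
  The finite sets of states and actions are types of class finite. A decision rule maps each
  state to a probability distribution on actions, so the type of policies is the set of all
  Markovian randomized policies.
\<close>

type_synonym ('s, 'a) kernel = "'s \<Rightarrow> 'a \<Rightarrow> 's pmf"
type_synonym ('s, 'a) decision_rule = "'s \<Rightarrow> 'a pmf"
type_synonym ('s, 'a) mr_policy = "nat \<Rightarrow> ('s, 'a) decision_rule"
type_synonym ('s, 'a) cost_fun = "'s \<Rightarrow> 'a \<Rightarrow> real"

text \<open>
  Conditional law of the pair (state, action) at time t, given the trajectory w up to time t - 1
  (only the pair at time t - 1 matters).
\<close>

fun step_law ::
  "('s, 'a) kernel \<Rightarrow> ('s, 'a) mr_policy \<Rightarrow> 's \<Rightarrow> nat \<Rightarrow> (nat \<Rightarrow> 's \<times> 'a) \<Rightarrow> ('s \<times> 'a) pmf"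
where
  "step_law p \<pi> x 0 w = map_pmf (\<lambda>a. (x, a)) (\<pi> 0 x)"
| "step_law p \<pi> x (Suc t) w =
     bind_pmf (p (fst (w t)) (snd (w t))) (\<lambda>s. map_pmf (\<lambda>a. (s, a)) (\<pi> (Suc t) s))"

abbreviation pair_space :: "nat \<Rightarrow> ('s \<times> 'a) measure" where
  "pair_space \<equiv> \<lambda>_. count_space UNIV"

text \<open>
  The law of the whole process on the product sigma-algebra of the space of trajectories, obtained
  from the one-step laws by the Ionescu-Tulcea theorem.
\<close>

definition traj_measure ::
  "('s, 'a) kernel \<Rightarrow> ('s, 'a) mr_policy \<Rightarrow> 's \<Rightarrow> (nat \<Rightarrow> 's \<times> 'a) measure" where
  "traj_measure p \<pi> x =
     projective_family.lim UNIV
       (Ionescu_Tulcea.CI (\<lambda>t w. measure_pmf (step_law p \<pi> x t w)) pair_space) pair_space"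

lemma Ionescu_Tulcea_step_law:
  fixes p :: "('s::finite, 'a::finite) kernel"
  shows "Ionescu_Tulcea (\<lambda>t w. measure_pmf (step_law p \<pi> x t w)) pair_space"
proof (rule Ionescu_Tulcea.intro)
  fix t
  show "(\<lambda>w. measure_pmf (step_law p \<pi> x t w))
      \<in> PiM {0..<t} pair_space \<rightarrow>\<^sub>M subprob_algebra (count_space UNIV)"
  proof (cases t)
    case 0
    then show ?thesis
      by (simp add: measure_pmf_in_subprob_algebra)
  next
    case (Suc n)
    let ?f = "\<lambda>y. measure_pmf (step_law p \<pi> x (Suc n) (\<lambda>_. y))"
    have "(\<lambda>w. ?f (w n)) \<in> PiM {0..<t} pair_space \<rightarrow>\<^sub>M subprob_algebra (count_space UNIV)"
    proof (rule measurable_compose[where g = ?f and N = "count_space UNIV"])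
      show "(\<lambda>w. w n) \<in> PiM {0..<t} pair_space \<rightarrow>\<^sub>M count_space UNIV"
        by (rule measurable_component_singleton) (simp add: Suc)
      show "?f \<in> count_space UNIV \<rightarrow>\<^sub>M subprob_algebra (count_space UNIV)"
        by (simp add: measure_pmf_in_subprob_algebra)
    qed
    then show ?thesis
      by (simp add: Suc)
  qed
next
  fix t and w :: "nat \<Rightarrow> 's \<times> 'a"
  assume "w \<in> space (PiM {0..<t} pair_space)"
  show "prob_space (measure_pmf (step_law p \<pi> x t w))"
    by (rule prob_space_measure_pmf)
qed

lemma sets_traj_measure [simp]:
  fixes p :: "('s::finite, 'a::finite) kernel"
  shows "sets (traj_measure p \<pi> x) = sets (PiM UNIV pair_space)"
proof -
  interpret Ionescu_Tulcea "\<lambda>t w. measure_pmf (step_law p \<pi> x t w)" pair_space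
    by (rule Ionescu_Tulcea_step_law)
  show ?thesis
    unfolding traj_measure_def by (rule PF.sets_lim)
qed

lemma emeasure_traj_measure:
  fixes p :: "('s::finite, 'a::finite) kernel"
  assumes "X \<in> sets (PiM {0..<n} pair_space)"
  shows "emeasure (traj_measure p \<pi> x) (prod_emb UNIV pair_space {0..<n} X) =
    emeasure (Ionescu_Tulcea.C (\<lambda>t w. measure_pmf (step_law p \<pi> x t w)) pair_space
      0 n (\<lambda>_. undefined)) X"
proof -
  interpret Ionescu_Tulcea "\<lambda>t w. measure_pmf (step_law p \<pi> x t w)" pair_space
    by (rule Ionescu_Tulcea_step_law)
  show ?thesis
    unfolding traj_measure_def using assms lim[of "{0..<n}" X]
      sets.sets_into_space[OF assms]
    by (simp add: emeasure_CI[of "{0..<n}" n] prod_emb_id space_PiM)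
qed

lemma prob_space_traj_measure:
  fixes p :: "('s::finite, 'a::finite) kernel"
  shows "prob_space (traj_measure p \<pi> x)"
proof -
  interpret Ionescu_Tulcea "\<lambda>t w. measure_pmf (step_law p \<pi> x t w)" pair_space
    by (rule Ionescu_Tulcea_step_law)
  interpret C: prob_space "C 0 0 (\<lambda>_. undefined)"
    by (rule prob_space_C) simp
  have "emeasure (traj_measure p \<pi> x) (space (traj_measure p \<pi> x)) = 1"
    using emeasure_traj_measure[of "space (PiM {0..<0} pair_space)" 0 p \<pi> x, OF sets.top] C.emeasure_space_1
    by (simp add: sets_eq_imp_space_eq[OF sets_traj_measure] space_PiM prod_emb_def restrict_def vimage_def)
  then show ?thesis
    by (rule prob_spaceI)
qed

text \<open>
  The series converges for discount factors in (0,1), cost functions on a finite domain being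
  bounded; the integrands below are then bounded and measurable.
\<close>

definition disc_cost :: "real \<Rightarrow> ('s, 'a) cost_fun \<Rightarrow> (nat \<Rightarrow> 's \<times> 'a) \<Rightarrow> real" where
  "disc_cost \<beta> R w = (\<Sum>t. \<beta> ^ t * R (fst (w t)) (snd (w t)))"

definition disc_cost_upto ::
  "real \<Rightarrow> ('s, 'a) cost_fun \<Rightarrow> nat \<Rightarrow> (nat \<Rightarrow> 's \<times> 'a) \<Rightarrow> real" where
  "disc_cost_upto \<beta> R T w = (\<Sum>t<T. \<beta> ^ t * R (fst (w t)) (snd (w t)))"

record ('s, 'a) problem =
  trans_prob :: "('s, 'a) kernel"
  discount :: real                         \<comment> \<open>\<open>\<beta>\<close>\<close>
  risk :: real                             \<comment> \<open>\<open>\<gamma>\<close>\<close>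
  start :: 's                              \<comment> \<open>the initial state x\<close>
  objective :: "('s, 'a) cost_fun"         \<comment> \<open>R\<close>
  num1 :: nat                              \<comment> \<open>M: infinite horizon, risk neutral\<close>
  cost1 :: "nat \<Rightarrow> ('s, 'a) cost_fun"
  bound1 :: "nat \<Rightarrow> real"
  num2 :: nat                              \<comment> \<open>M hat: infinite horizon, risk sensitive\<close>
  cost2 :: "nat \<Rightarrow> ('s, 'a) cost_fun"
  bound2 :: "nat \<Rightarrow> real"
  num3 :: nat                              \<comment> \<open>M bar: finite horizon, risk neutral\<close>
  cost3 :: "nat \<Rightarrow> ('s, 'a) cost_fun"
  bound3 :: "nat \<Rightarrow> real"
  horizon3 :: "nat \<Rightarrow> nat"
  num4 :: nat                              \<comment> \<open>M check: finite horizon, risk sensitive\<close>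
  cost4 :: "nat \<Rightarrow> ('s, 'a) cost_fun"
  bound4 :: "nat \<Rightarrow> real"
  horizon4 :: "nat \<Rightarrow> nat"

definition expect ::
  "('s, 'a) problem \<Rightarrow> ('s, 'a) mr_policy \<Rightarrow> ((nat \<Rightarrow> 's \<times> 'a) \<Rightarrow> real) \<Rightarrow> real" where
  "expect D \<pi> f = (\<integral>w. f w \<partial>traj_measure (trans_prob D) \<pi> (start D))"

definition J_inf :: "('s, 'a) problem \<Rightarrow> ('s, 'a) cost_fun \<Rightarrow> ('s, 'a) mr_policy \<Rightarrow> real" where
  "J_inf D R \<pi> = expect D \<pi> (\<lambda>w. exp (risk D * disc_cost (discount D) R w))"

definition J_fin ::
  "('s, 'a) problem \<Rightarrow> ('s, 'a) cost_fun \<Rightarrow> nat \<Rightarrow> ('s, 'a) mr_policy \<Rightarrow> real" where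
  "J_fin D R T \<pi> = expect D \<pi> (\<lambda>w. exp (risk D * disc_cost_upto (discount D) R T w))"

definition v_inf :: "('s, 'a) problem \<Rightarrow> ('s, 'a) cost_fun \<Rightarrow> ('s, 'a) mr_policy \<Rightarrow> real" where
  "v_inf D R \<pi> = expect D \<pi> (disc_cost (discount D) R)"

definition v_fin ::
  "('s, 'a) problem \<Rightarrow> ('s, 'a) cost_fun \<Rightarrow> nat \<Rightarrow> ('s, 'a) mr_policy \<Rightarrow> real" where
  "v_fin D R T \<pi> = expect D \<pi> (disc_cost_upto (discount D) R T)"

definition K_const :: "('s, 'a) problem \<Rightarrow> real \<Rightarrow> real" where
  "K_const D C = C / (1 - discount D)"

definition K_T :: "('s, 'a) problem \<Rightarrow> real \<Rightarrow> nat \<Rightarrow> real" where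
  "K_T D C T = exp (\<bar>risk D\<bar> * K_const D C * discount D ^ T)"

definition constr1 :: "('s, 'a) problem \<Rightarrow> ('s, 'a) mr_policy set" where
  "constr1 D = {\<pi>. \<forall>i\<in>{1..num1 D}. v_inf D (cost1 D i) \<pi> \<le> bound1 D i}"

definition constr2 :: "('s, 'a) problem \<Rightarrow> ('s, 'a) mr_policy set" where
  "constr2 D = {\<pi>. \<forall>j\<in>{1..num2 D}. J_inf D (cost2 D j) \<pi> \<le> bound2 D j}"

definition constr3 :: "('s, 'a) problem \<Rightarrow> ('s, 'a) mr_policy set" where
  "constr3 D = {\<pi>. \<forall>k\<in>{1..num3 D}. v_fin D (cost3 D k) (horizon3 D k) \<pi> \<le> bound3 D k}"

definition constr4 :: "('s, 'a) problem \<Rightarrow> ('s, 'a) mr_policy set" where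
  "constr4 D = {\<pi>. \<forall>l\<in>{1..num4 D}. J_fin D (cost4 D l) (horizon4 D l) \<pi> \<le> bound4 D l}"

definition constr1_plus :: "('s, 'a) problem \<Rightarrow> real \<Rightarrow> nat \<Rightarrow> ('s, 'a) mr_policy set" where
  "constr1_plus D C T =
     {\<pi>. \<forall>i\<in>{1..num1 D}. v_fin D (cost1 D i) T \<pi> \<le> bound1 D i + K_const D C * discount D ^ T}"

definition constr2_plus :: "('s, 'a) problem \<Rightarrow> real \<Rightarrow> nat \<Rightarrow> ('s, 'a) mr_policy set" where
  "constr2_plus D C T =
     {\<pi>. \<forall>j\<in>{1..num2 D}. J_fin D (cost2 D j) T \<pi> \<le> bound2 D j * K_T D C T}"

definition feasible :: "('s, 'a) problem \<Rightarrow> ('s, 'a) mr_policy set" where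
  "feasible D = constr1 D \<inter> constr2 D \<inter> constr3 D \<inter> constr4 D"

definition feasible_plus :: "('s, 'a) problem \<Rightarrow> real \<Rightarrow> nat \<Rightarrow> ('s, 'a) mr_policy set" where
  "feasible_plus D C T =
     constr1_plus D C T \<inter> constr2_plus D C T \<inter> constr3 D \<inter> constr4 D"

definition eps_feasible :: "('s, 'a) problem \<Rightarrow> real \<Rightarrow> ('s, 'a) mr_policy \<Rightarrow> bool" where
  "eps_feasible D \<epsilon> \<pi> \<longleftrightarrow>
     (\<forall>i\<in>{1..num1 D}. v_inf D (cost1 D i) \<pi> \<le> bound1 D i + \<epsilon>) \<and>
     (\<forall>j\<in>{1..num2 D}. J_inf D (cost2 D j) \<pi> \<le> bound2 D j + \<epsilon>) \<and>
     (\<forall>k\<in>{1..num3 D}. v_fin D (cost3 D k) (horizon3 D k) \<pi> \<le> bound3 D k + \<epsilon>) \<and>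
     (\<forall>l\<in>{1..num4 D}. J_fin D (cost4 D l) (horizon4 D l) \<pi> \<le> bound4 D l + \<epsilon>)"

definition cost_bound :: "('s, 'a) problem \<Rightarrow> real \<Rightarrow> bool" where
  "cost_bound D C \<longleftrightarrow>
     (\<forall>s a. \<bar>objective D s a\<bar> \<le> C \<and>
        (\<forall>i\<in>{1..num1 D}. \<bar>cost1 D i s a\<bar> \<le> C) \<and>
        (\<forall>j\<in>{1..num2 D}. \<bar>cost2 D j s a\<bar> \<le> C) \<and>
        (\<forall>k\<in>{1..num3 D}. \<bar>cost3 D k s a\<bar> \<le> C) \<and>
        (\<forall>l\<in>{1..num4 D}. \<bar>cost4 D l s a\<bar> \<le> C))"

end

theory Submission
  imports Defs
begin

text \<open>
  Truncating the discounted cost at time \<open>T\<close> changes it by at most \<open>K * \<beta> ^ T\<close>, uniformly in the policy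
  (\<open>v_truncation\<close>); for exponential costs the same estimate is multiplicative, with factor
  \<open>K_T D C T\<close> (\<open>J_sandwich\<close>). The relaxation of the constraints in \<open>feasible_plus\<close> is exactly what this
  error requires, so the relaxed set contains \<open>feasible D\<close>, while its members violate the original
  constraints by an amount that tends to 0. This gives \<open>\<epsilon>\<close>-feasibility. It also gives one half of the
  value estimate: a minimizer \<open>\<eta>\<close> of the truncated problem beats every feasible policy at horizon \<open>T\<close>,
  and passing back and forth between the two horizons costs the factor \<open>(K_T D C T)\<^sup>2\<close>, which tends
  to 1 (\<open>minimizer_value_le\<close>).

  The other half says that relaxing the constraints cannot lower the optimal value by much
  (\<open>eventually_relaxed_value_ge\<close>), and rests on compactness. Policies, with pointwise
  convergence of the action probabilities, form a sequentially compact space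
  (\<open>policy_seq_compact\<close>). Finite-horizon expectations are continuous, because the law of a finite
  prefix of the trajectory is a product of one-step probabilities
  (\<open>integral_traj_prefix\<close>), and infinite-horizon ones are continuous as uniform limits of these. If relaxed feasible
  policies with values at most the infimum minus \<open>\<epsilon>\<close> existed at arbitrarily large horizons, a limit
  of them would be feasible (\<open>limit_of_relaxed_feasible\<close>) and would have a value below the
  infimum.
\<close>

section \<open>The law of a finite prefix of the trajectory\<close>

lemma step_law_cong:
  assumes "\<And>i. i < t \<Longrightarrow> w i = w' i"
  shows "step_law p \<pi> x t w = step_law p \<pi> x t w'"
  using assms by (cases t) auto

lemma sets_singleton_PiM:
  fixes v :: "nat \<Rightarrow> 's \<times> 'a"
  shows "{restrict v {0..<n}} \<in> sets (PiM {0..<n} pair_space)"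
proof -
  have "{restrict v {0..<n}} = PiE {0..<n} (\<lambda>i. {v i})"
    by (simp add: PiE_singleton restrict_def fun_eq_iff PiE_def extensional_def set_eq_iff Pi_def) metis
  then show ?thesis
    by (simp add: sets_PiM_I_finite)
qed

text \<open>
  The Ionescu-Tulcea construction on \<open>{0..<n}\<close> is an iterated bind; on a single prefix each step
  contributes one factor, since extending a prefix \<open>w\<close> reaches \<open>v\<close> only if \<open>w\<close> already agrees with \<open>v\<close>.
\<close>

lemma emeasure_Ionescu_Tulcea_C_singleton:
  fixes p :: "('s::finite, 'a::finite) kernel"
  shows "emeasure (Ionescu_Tulcea.C (\<lambda>t w. measure_pmf (step_law p \<pi> x t w)) pair_space
      0 n (\<lambda>_. undefined)) {restrict v {0..<n}} =
    (\<Prod>i<n. ennreal (pmf (step_law p \<pi> x i v) (v i)))"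
proof -
  interpret Ionescu_Tulcea "\<lambda>t w. measure_pmf (step_law p \<pi> x t w)" pair_space
    by (rule Ionescu_Tulcea_step_law)
  have u: "(\<lambda>_. undefined) \<in> space (PiM {0..<0} (pair_space :: nat \<Rightarrow> ('s \<times> 'a) measure))"
    by (simp add: space_PiM)
  show ?thesis
  proof (induction n)
    case 0
    have "restrict v {0..<0} = (\<lambda>_. undefined)" by (simp add: restrict_def)
    then show ?case
      using sets_singleton_PiM[of v 0] by (simp add: restrict_def)
  next
    case (Suc n)
    let ?q = "ennreal (pmf (step_law p \<pi> x n v) (v n))"
    have sp: "space (C 0 n (\<lambda>_. undefined)) = space (PiM {0..<n} pair_space)"
      using space_C[OF u, of n] by simp
    have e: "emeasure (eP n w) {restrict v {0..<Suc n}} = ?q * indicator {restrict v {0..<n}} w"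
      if w: "w \<in> space (PiM {0..<n} pair_space)" for w
    proof -
      have ext: "w i = undefined" if "\<not> i < n" for i
        using w that by (auto simp: space_PiM PiE_def extensional_def)
      have eq: "w(n := y) = restrict v {0..<Suc n} \<longleftrightarrow> w = restrict v {0..<n} \<and> y = v n" for y
      proof
        assume a: "w(n := y) = restrict v {0..<Suc n}"
        have "w i = restrict v {0..<n} i" for i
          using fun_cong[OF a, of i] ext[of i] by (cases "i < n") auto
        moreover have "y = v n" using fun_cong[OF a, of n] by simp
        ultimately show "w = restrict v {0..<n} \<and> y = v n" by blast
      qed (auto simp: fun_eq_iff restrict_def)
      have "emeasure (eP n w) {restrict v {0..<Suc n}} =
          emeasure (measure_pmf (step_law p \<pi> x n w)) {y. w(n := y) = restrict v {0..<Suc n}}"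
        by (subst emeasure_eP[OF w sets_singleton_PiM]) (simp add: vimage_def)
      also have "\<dots> = ?q * indicator {restrict v {0..<n}} w"
      proof (cases "w = restrict v {0..<n}")
        case True
        have "step_law p \<pi> x n w = step_law p \<pi> x n v"
          by (rule step_law_cong) (simp add: True)
        then show ?thesis
          unfolding eq by (simp add: True emeasure_pmf_single)
      qed (simp add: eq)
      finally show ?thesis .
    qed
    have "emeasure (C 0 (Suc n) (\<lambda>_. undefined)) {restrict v {0..<Suc n}} =
        (\<integral>\<^sup>+w. emeasure (eP n w) {restrict v {0..<Suc n}} \<partial>C 0 n (\<lambda>_. undefined))"
    proof -
      have "space (C 0 n (\<lambda>_. undefined)) \<noteq> {}"
        unfolding sp by (simp add: space_PiM PiE_eq_empty_iff)
      moreover have "eP n \<in> measurable (C 0 n (\<lambda>_. undefined)) (subprob_algebra (PiM {0..<Suc n} pair_space))"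
        using measurable_eP[of n] sets_C[OF u, of n] by (simp cong: measurable_cong_sets)
      ultimately show ?thesis
        by (simp add: emeasure_bind[OF _ _ sets_singleton_PiM])
    qed
    also have "\<dots> = (\<integral>\<^sup>+w. ?q * indicator {restrict v {0..<n}} w \<partial>C 0 n (\<lambda>_. undefined))"
      by (rule nn_integral_cong) (simp add: e sp)
    also have "\<dots> = ?q * emeasure (C 0 n (\<lambda>_. undefined)) {restrict v {0..<n}}"
      by (rule nn_integral_cmult_indicator)
         (use sets_C[OF u, of n] sets_singleton_PiM[of v n] in simp)
    finally show ?case
      by (simp only: Suc.IH prod.lessThan_Suc mult.commute)
  qed
qed

lemma cylinder_eq_prod_emb:
  "{w. restrict w {0..<n} = restrict v {0..<n}} =
    prod_emb UNIV pair_space {0..<n} {restrict v {0..<n}}"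
  by (auto simp: prod_emb_def)

lemma sets_cylinder:
  "{w. restrict w {0..<n} = restrict v {0..<n}} \<in> sets (PiM UNIV pair_space)"
  unfolding cylinder_eq_prod_emb
  by (rule measurable_prod_emb[OF _ sets_singleton_PiM]) simp

lemma measure_traj_cylinder:
  fixes p :: "('s::finite, 'a::finite) kernel"
  shows "measure (traj_measure p \<pi> x) {w. restrict w {0..<n} = restrict v {0..<n}} =
    (\<Prod>i<n. pmf (step_law p \<pi> x i v) (v i))"
  unfolding measure_def cylinder_eq_prod_emb
  by (simp add: emeasure_traj_measure[OF sets_singleton_PiM] emeasure_Ionescu_Tulcea_C_singleton
      prod_ennreal prod_nonneg)

text \<open>
  There are finitely many prefixes of length \<open>n\<close>, so the cylinders they determine form a finite
  partition of the trajectories, on each piece of which the integrand is constant. The policy enters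
  the resulting finite sum only through its one-step probabilities.
\<close>

lemma integral_traj_prefix:
  fixes p :: "('s::finite, 'a::finite) kernel" and F :: "(nat \<Rightarrow> 's \<times> 'a) \<Rightarrow> real"
  shows "(\<integral>w. F (restrict w {0..<n}) \<partial>traj_measure p \<pi> x) =
    (\<Sum>v\<in>PiE {0..<n} (\<lambda>_. UNIV). (\<Prod>i<n. pmf (step_law p \<pi> x i v) (v i)) * F v)"
proof -
  let ?M = "traj_measure p \<pi> x" and ?V = "PiE {0..<n} (\<lambda>_. UNIV) :: (nat \<Rightarrow> 's \<times> 'a) set"
  let ?cyl = "\<lambda>v. {w. restrict w {0..<n} = restrict v {0..<n}} :: (nat \<Rightarrow> 's \<times> 'a) set"
  interpret prob_space ?M by (rule prob_space_traj_measure)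
  have fin: "finite ?V" by (simp add: finite_PiE)
  have cyl: "?cyl v \<in> sets ?M" for v by (simp add: sets_cylinder)
  have "F (restrict w {0..<n}) = (\<Sum>v\<in>?V. F v * indicator (?cyl v) w)" for w
  proof -
    have "(\<Sum>v\<in>?V. F v * indicator (?cyl v) w) =
        (\<Sum>v\<in>?V. if v = restrict w {0..<n} then F v else 0)"
    proof (rule sum.cong[OF refl])
      fix v assume "v \<in> ?V"
      then have "restrict v {0..<n} = v" by (simp add: PiE_restrict)
      then show "F v * indicator (?cyl v) w = (if v = restrict w {0..<n} then F v else 0)"
        by (auto simp: indicator_def)
    qed
    also have "\<dots> = F (restrict w {0..<n})"
      using fin by (simp add: sum.delta)
    finally show ?thesis by simp
  qed
  then have "(\<integral>w. F (restrict w {0..<n}) \<partial>?M) = (\<integral>w. (\<Sum>v\<in>?V. F v * indicator (?cyl v) w) \<partial>?M)"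
    by (intro Bochner_Integration.integral_cong) auto
  also have "\<dots> = (\<Sum>v\<in>?V. \<integral>w. F v * indicator (?cyl v) w \<partial>?M)"
    by (rule Bochner_Integration.integral_sum, rule integrable_mult_right, rule integrable_real_indicator)
       (rule cyl, simp add: emeasure_eq_measure)
  also have "\<dots> = (\<Sum>v\<in>?V. F v * measure ?M (?cyl v))"
    by (simp add: sets_eq_imp_space_eq[OF sets_traj_measure] space_PiM)
  finally have "(\<integral>w. F (restrict w {0..<n}) \<partial>?M) = (\<Sum>v\<in>?V. F v * measure ?M (?cyl v))" .
  then show ?thesis
    by (simp only: measure_traj_cylinder mult.commute)
qed

section \<open>Convergence and compactness of policies\<close>

text \<open>
  Convergence in the product topology. As there are finitely many actions, it is the same as
  weak convergence of the action distributions at every time and state.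
\<close>

definition policy_tendsto ::
  "(nat \<Rightarrow> ('s, 'a) mr_policy) \<Rightarrow> ('s, 'a) mr_policy \<Rightarrow> bool" where
  "policy_tendsto \<eta> \<pi> \<longleftrightarrow> (\<forall>t s a. (\<lambda>n. pmf (\<eta> n t s) a) \<longlonglongrightarrow> pmf (\<pi> t s) a)"

lemma pmf_map_Pair: "pmf (map_pmf (\<lambda>a. (s, a)) q) y = (if fst y = s then pmf q (snd y) else 0)"
proof (cases "fst y = s")
  case True
  then have "y = (s, snd y)" by (cases y) auto
  then show ?thesis
    using pmf_map_inj'[of "\<lambda>a. (s, a)" q "snd y"] True by (simp add: inj_on_def)
next
  case False
  then have "y \<notin> (\<lambda>a. (s, a)) ` set_pmf q" by auto
  then show ?thesis using False by (simp add: pmf_map_outside)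
qed

lemma step_law_tendsto:
  fixes p :: "('s::finite, 'a::finite) kernel"
  assumes "policy_tendsto \<eta> \<pi>"
  shows "(\<lambda>n. pmf (step_law p (\<eta> n) x t w) y) \<longlonglongrightarrow> pmf (step_law p \<pi> x t w) y"
proof -
  have lim: "(\<lambda>n. pmf (\<eta> n t s) a) \<longlonglongrightarrow> pmf (\<pi> t s) a" for t s a
    using assms by (simp add: policy_tendsto_def)
  have pair: "(\<lambda>n. pmf (map_pmf (\<lambda>a. (s, a)) (\<eta> n t s)) y)
      \<longlonglongrightarrow> pmf (map_pmf (\<lambda>a. (s, a)) (\<pi> t s)) y" for t s
    by (cases "fst y = s") (simp_all add: pmf_map_Pair lim)
  show ?thesis
  proof (cases t)
    case (Suc u)
    have "pmf (step_law p \<rho> x t w) y =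
        (\<Sum>s\<in>UNIV. pmf (map_pmf (\<lambda>a. (s, a)) (\<rho> t s)) y * pmf (p (fst (w u)) (snd (w u))) s)" for \<rho>
      unfolding Suc step_law.simps pmf_bind
      by (rule integral_measure_pmf_real) auto
    then show ?thesis
      by (auto intro!: tendsto_intros pair)
  qed (use pair in simp)
qed

text \<open>
  The expectation is a finite sum of products of one-step probabilities, with weights that do not
  depend on the policy.
\<close>

lemma expect_prefix_tendsto:
  fixes D :: "('s::finite, 'a::finite) problem"
  assumes "policy_tendsto \<eta> \<pi>" and "\<And>w. F w = F (restrict w {0..<n})"
  shows "(\<lambda>k. expect D (\<eta> k) F) \<longlonglongrightarrow> expect D \<pi> F"
proof -
  have "expect D \<rho> F = (\<Sum>v\<in>PiE {0..<n} (\<lambda>_. UNIV).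
      (\<Prod>i<n. pmf (step_law (trans_prob D) \<rho> (start D) i v) (v i)) * F v)" for \<rho>
    unfolding expect_def integral_traj_prefix[symmetric] by (simp flip: assms(2))
  then show ?thesis
    by (auto intro!: tendsto_intros step_law_tendsto assms(1))
qed

text \<open>
  A policy is a point of the cube of all functions from times, states and actions to the unit
  interval. The cube is compact by Tychonoff's theorem and metrizable because the index set is
  countable. A limit of policies is again a policy because the finite sums over
  actions converge, so that no mass is lost.
\<close>

lemma policy_seq_compact:
  fixes \<eta> :: "nat \<Rightarrow> ('s::finite, 'a::finite) mr_policy"
  obtains \<pi> r where "strict_mono r" and "policy_tendsto (\<eta> \<circ> r) \<pi>"
proof -
  define f where "f n = (\<lambda>(t, s, a). pmf (\<eta> n t s) a)" for n
  let ?S = "PiE UNIV (\<lambda>_. {0..1}) :: (nat \<times> 's \<times> 'a \<Rightarrow> real) set"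
  have "compactin (product_topology (\<lambda>_. euclidean) UNIV) ?S"
    unfolding compactin_PiE by simp
  then have "compact ?S"
    by (simp add: euclidean_product_topology)
  moreover have "f n \<in> ?S" for n
    by (auto simp: f_def pmf_le_1)
  ultimately obtain l r where r: "strict_mono r" and l: "(f \<circ> r) \<longlonglongrightarrow> l"
    using compact_imp_seq_compact[of ?S] unfolding seq_compact_def by metis
  have "(\<lambda>n. (f \<circ> r) n y) \<longlonglongrightarrow> l y" for y
    by (rule continuous_on_tendsto_compose[OF continuous_on_product_coordinates l]) simp_all
  from this[of "(_, _, _)"] have l: "(\<lambda>n. pmf (\<eta> (r n) t s) a) \<longlonglongrightarrow> l (t, s, a)" for t s a
    by (simp add: f_def)
  have nonneg: "0 \<le> l (t, s, a)" for t s a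
    by (rule LIMSEQ_le_const[OF l]) simp
  have one: "(\<Sum>a\<in>UNIV. l (t, s, a)) = 1" for t s
  proof (rule LIMSEQ_unique)
    show "(\<lambda>n. \<Sum>a\<in>UNIV. pmf (\<eta> (r n) t s) a) \<longlonglongrightarrow> (\<Sum>a\<in>UNIV. l (t, s, a))"
      by (intro tendsto_sum l)
    show "(\<lambda>n. \<Sum>a\<in>UNIV. pmf (\<eta> (r n) t s) a) \<longlonglongrightarrow> 1"
      by (simp add: sum_pmf_eq_1)
  qed
  have "pmf (embed_pmf (\<lambda>a. l (t, s, a))) a = l (t, s, a)" for t s a
    by (rule pmf_embed_pmf)
       (simp_all add: nonneg one nn_integral_count_space_finite sum_ennreal)
  then have "policy_tendsto (\<eta> \<circ> r) (\<lambda>t s. embed_pmf (\<lambda>a. l (t, s, a)))"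
    using l by (simp add: policy_tendsto_def)
  with r show ?thesis by (rule that)
qed

lemma disc_cost_upto_restrict:
  "disc_cost_upto \<beta> R T w = disc_cost_upto \<beta> R T (restrict w {0..<T})"
  by (simp add: disc_cost_upto_def)

lemma J_fin_tendsto:
  fixes D :: "('s::finite, 'a::finite) problem"
  assumes "policy_tendsto \<eta> \<pi>"
  shows "(\<lambda>n. J_fin D R T (\<eta> n)) \<longlonglongrightarrow> J_fin D R T \<pi>"
  unfolding J_fin_def
  by (rule expect_prefix_tendsto[OF assms]) (subst disc_cost_upto_restrict, rule refl)

lemma v_fin_tendsto:
  fixes D :: "('s::finite, 'a::finite) problem"
  assumes "policy_tendsto \<eta> \<pi>"
  shows "(\<lambda>n. v_fin D R T (\<eta> n)) \<longlonglongrightarrow> v_fin D R T \<pi>"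
  unfolding v_fin_def
  by (rule expect_prefix_tendsto[OF assms]) (rule disc_cost_upto_restrict)

lemma tendsto_of_uniform_approximation:
  fixes f :: "nat \<Rightarrow> 'c \<Rightarrow> real"
  assumes f: "\<And>T. (\<lambda>n. f T (\<eta> n)) \<longlonglongrightarrow> f T \<pi>"
    and approx: "\<And>T \<rho>. \<bar>f T \<rho> - g \<rho>\<bar> \<le> \<delta> T" and \<delta>: "\<delta> \<longlonglongrightarrow> 0"
  shows "(\<lambda>n. g (\<eta> n)) \<longlonglongrightarrow> g \<pi>"
proof (rule LIMSEQ_I)
  fix e :: real assume e: "0 < e"
  then obtain T where T: "\<bar>\<delta> T\<bar> < e / 3"
    using LIMSEQ_D[OF \<delta>, of "e / 3"] by auto
  obtain N where N: "\<And>n. n \<ge> N \<Longrightarrow> \<bar>f T (\<eta> n) - f T \<pi>\<bar> < e / 3"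
    using LIMSEQ_D[OF f[of T], of "e / 3"] e by auto
  have "norm (g (\<eta> n) - g \<pi>) < e" if "n \<ge> N" for n
    using N[OF that] approx[of T "\<eta> n"] approx[of T \<pi>] T by (simp add: abs_if split: if_splits)
  then show "\<exists>N. \<forall>n\<ge>N. norm (g (\<eta> n) - g \<pi>) < e" by blast
qed

section \<open>Truncation estimates\<close>

locale discounted =
  fixes D :: "('s::finite, 'a::finite) problem" and C :: real
  assumes discount_pos: "0 < discount D" and discount_less_1: "discount D < 1"
    and C_nonneg: "0 \<le> C"
begin

abbreviation "\<beta> \<equiv> discount D"
abbreviation "\<gamma> \<equiv> risk D"
abbreviation "K \<equiv> K_const D C"

lemma K_nonneg: "0 \<le> K"
  using C_nonneg discount_less_1 by (simp add: K_const_def)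

lemma K_T_ge_1: "1 \<le> K_T D C T"
  using K_nonneg discount_pos by (simp add: K_T_def)

lemma truncation_tendsto_0: "(\<lambda>T. K * \<beta> ^ T) \<longlonglongrightarrow> 0"
  using discount_pos discount_less_1 by (intro tendsto_mult_right_zero LIMSEQ_power_zero) simp

lemma K_T_tendsto_1: "K_T D C \<longlonglongrightarrow> 1"
proof -
  have "(\<lambda>T. exp (\<bar>\<gamma>\<bar> * (K * \<beta> ^ T))) \<longlonglongrightarrow> exp (\<bar>\<gamma>\<bar> * 0)"
    by (intro tendsto_exp tendsto_mult_left truncation_tendsto_0)
  then show ?thesis
    by (simp add: K_T_def[abs_def] mult.assoc)
qed

context
  fixes R :: "('s, 'a) cost_fun"
  assumes cost_le: "\<forall>s a. \<bar>R s a\<bar> \<le> C"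
begin

text \<open>The tail is dominated by the geometric series with first term \<open>C * \<beta> ^ T\<close>.\<close>

lemma disc_cost_truncation: "\<bar>disc_cost \<beta> R w - disc_cost_upto \<beta> R T w\<bar> \<le> K * \<beta> ^ T"
proof -
  let ?f = "\<lambda>t. \<beta> ^ t * R (fst (w t)) (snd (w t))"
  let ?g = "\<lambda>t. C * \<beta> ^ T * \<beta> ^ t"
  have geo: "?g sums (C * \<beta> ^ T * (1 / (1 - \<beta>)))"
    using discount_pos discount_less_1 by (intro sums_mult geometric_sums) simp
  have fg: "norm (?f (t + T)) \<le> ?g t" for t
    using discount_pos mult_left_mono[OF cost_le[rule_format, of "fst (w (t + T))" "snd (w (t + T))"], of "\<beta> ^ (t + T)"]
    by (simp add: abs_mult power_add mult_ac)
  have sg: "summable ?g" using geo by (rule sums_summable)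
  have sf: "summable (\<lambda>t. ?f (t + T))"
    by (rule summable_comparison_test[OF _ sg]) (use fg in blast)
  have "disc_cost \<beta> R w - disc_cost_upto \<beta> R T w = (\<Sum>t. ?f (t + T))"
    unfolding disc_cost_def disc_cost_upto_def
    using suminf_split_initial_segment[of ?f T] sf by (simp add: summable_iff_shift[of ?f T])
  moreover have "norm (\<Sum>t. ?f (t + T)) \<le> suminf ?g"
    by (rule norm_suminf_le[OF fg sg])
  ultimately show ?thesis
    using geo by (simp add: K_const_def sums_iff)
qed

lemma disc_cost_le: "\<bar>disc_cost \<beta> R w\<bar> \<le> K"
  using disc_cost_truncation[of w 0] by (simp add: disc_cost_upto_def)

text \<open>A crude bound, enough for integrability.\<close>

lemma disc_cost_upto_le: "\<bar>disc_cost_upto \<beta> R T w\<bar> \<le> 2 * K"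
proof -
  have "K * \<beta> ^ T \<le> K"
    using K_nonneg discount_pos discount_less_1 by (simp add: mult_left_le power_le_one)
  then show ?thesis
    using disc_cost_truncation[of w T] disc_cost_le[of w] by linarith
qed

end

lemma borel_measurable_disc_cost [measurable]:
  fixes p :: "('s, 'a) kernel" and x :: 's
  shows
  "disc_cost \<beta> R \<in> borel_measurable (traj_measure p \<pi> x)"
  "disc_cost_upto \<beta> R T \<in> borel_measurable (traj_measure p \<pi> x)"
proof -
  have "(\<lambda>w. R (fst (w t)) (snd (w t))) \<in> borel_measurable (PiM UNIV pair_space)" for t
    by (rule measurable_compose[where g = "\<lambda>y. R (fst y) (snd y)" and N = "count_space UNIV"]) simp_all
  then have [measurable]: "(\<lambda>w. R (fst (w t)) (snd (w t))) \<in> borel_measurable (traj_measure p \<pi> x)" for t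
    by (subst measurable_cong_sets[OF sets_traj_measure refl])
  show "disc_cost \<beta> R \<in> borel_measurable (traj_measure p \<pi> x)"
    unfolding disc_cost_def[abs_def] by measurable
  show "disc_cost_upto \<beta> R T \<in> borel_measurable (traj_measure p \<pi> x)"
    unfolding disc_cost_upto_def[abs_def] by measurable
qed

lemma integrable_traj_bounded:
  fixes p :: "('s, 'a) kernel" and x :: 's
  assumes "f \<in> borel_measurable (traj_measure p \<pi> x)" and "\<And>w. \<bar>f w\<bar> \<le> (B::real)"
  shows "integrable (traj_measure p \<pi> x) f"
proof -
  interpret prob_space "traj_measure p \<pi> x" by (rule prob_space_traj_measure)
  show ?thesis by (rule integrable_const_bound[of _ B]) (use assms in auto)
qed

lemma risk_le: "\<bar>s\<bar> \<le> B \<Longrightarrow> \<gamma> * s \<le> \<bar>\<gamma>\<bar> * B"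
  using abs_ge_self[of "\<gamma> * s"] mult_left_mono[of "\<bar>s\<bar>" B "\<bar>\<gamma>\<bar>"] by (simp add: abs_mult)

context
  fixes R :: "('s, 'a) cost_fun"
  assumes cost_le: "\<forall>s a. \<bar>R s a\<bar> \<le> C"
begin

lemma integrable_costs:
  "integrable (traj_measure p \<pi> x) (disc_cost \<beta> R)"
  "integrable (traj_measure p \<pi> x) (disc_cost_upto \<beta> R T)"
  "integrable (traj_measure p \<pi> x) (\<lambda>w. exp (\<gamma> * disc_cost \<beta> R w))"
  "integrable (traj_measure p \<pi> x) (\<lambda>w. exp (\<gamma> * disc_cost_upto \<beta> R T w))"
proof -
  note b = disc_cost_le[OF cost_le] disc_cost_upto_le[OF cost_le]
  show "integrable (traj_measure p \<pi> x) (disc_cost \<beta> R)"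
    by (rule integrable_traj_bounded[OF _ b(1)]) measurable
  show "integrable (traj_measure p \<pi> x) (disc_cost_upto \<beta> R T)"
    by (rule integrable_traj_bounded[OF _ b(2)]) measurable
  show "integrable (traj_measure p \<pi> x) (\<lambda>w. exp (\<gamma> * disc_cost \<beta> R w))"
    by (rule integrable_traj_bounded[where B = "exp (\<bar>\<gamma>\<bar> * K)"], measurable)
       (simp add: risk_le b)
  show "integrable (traj_measure p \<pi> x) (\<lambda>w. exp (\<gamma> * disc_cost_upto \<beta> R T w))"
    by (rule integrable_traj_bounded[where B = "exp (\<bar>\<gamma>\<bar> * (2 * K))"], measurable)
       (simp only: abs_exp_cancel exp_le_cancel_iff risk_le b)
qed

lemma v_truncation: "\<bar>v_fin D R T \<pi> - v_inf D R \<pi>\<bar> \<le> K * \<beta> ^ T"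
proof -
  let ?M = "traj_measure (trans_prob D) \<pi> (start D)"
  interpret prob_space ?M by (rule prob_space_traj_measure)
  have "\<bar>v_fin D R T \<pi> - v_inf D R \<pi>\<bar> =
      \<bar>\<integral>w. disc_cost_upto \<beta> R T w - disc_cost \<beta> R w \<partial>?M\<bar>"
    unfolding v_fin_def v_inf_def expect_def by (simp add: integrable_costs)
  also have "\<dots> \<le> (\<integral>w. \<bar>disc_cost_upto \<beta> R T w - disc_cost \<beta> R w\<bar> \<partial>?M)"
    by (rule integral_abs_bound)
  also have "\<dots> \<le> (\<integral>w. K * \<beta> ^ T \<partial>?M)"
    using disc_cost_truncation[OF cost_le]
    by (intro integral_mono) (simp_all add: integrable_costs abs_minus_commute)
  finally show ?thesis by (simp add: prob_space)
qed

text \<open>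
  The additive truncation error of the cost becomes, pathwise, a multiplicative error of the
  exponential, and so survives integration as the factor \<open>K_T D C T\<close>.
\<close>

lemma J_sandwich:
  "J_fin D R T \<pi> \<le> K_T D C T * J_inf D R \<pi>"
  "J_inf D R \<pi> \<le> K_T D C T * J_fin D R T \<pi>"
proof -
  have pointwise: "exp (\<gamma> * s) \<le> K_T D C T * exp (\<gamma> * s')" if "\<bar>s - s'\<bar> \<le> K * \<beta> ^ T" for s s'
    using risk_le[OF that] by (simp add: K_T_def flip: exp_add) (simp add: algebra_simps)
  note trunc = disc_cost_truncation[OF cost_le]
  show "J_fin D R T \<pi> \<le> K_T D C T * J_inf D R \<pi>"
    unfolding J_fin_def J_inf_def expect_def integral_mult_right_zero[symmetric]
    by (intro integral_mono integrable_mult_right integrable_costs pointwise)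
       (subst abs_minus_commute, rule trunc)
  show "J_inf D R \<pi> \<le> K_T D C T * J_fin D R T \<pi>"
    unfolding J_fin_def J_inf_def expect_def integral_mult_right_zero[symmetric]
    by (intro integral_mono integrable_mult_right integrable_costs pointwise trunc)
qed

lemma J_inf_bounds: "0 \<le> J_inf D R \<pi>" "J_inf D R \<pi> \<le> K_T D C 0"
proof -
  interpret prob_space "traj_measure (trans_prob D) \<pi> (start D)"
    by (rule prob_space_traj_measure)
  show "0 \<le> J_inf D R \<pi>" unfolding J_inf_def expect_def by simp
  (* the cost truncated at horizon 0 is 0, so that J_fin is 1 there *)
  show "J_inf D R \<pi> \<le> K_T D C 0"
    using J_sandwich(2)[of \<pi> 0] by (simp add: J_fin_def expect_def disc_cost_upto_def prob_space)
qed

text \<open>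
  An additive form of the multiplicative estimate, whose right-hand side no longer depends on the
  policy: the limit argument below needs uniform approximation.
\<close>

lemma J_truncation: "\<bar>J_fin D R T \<pi> - J_inf D R \<pi>\<bar> \<le> (K_T D C T - 1) * (K_T D C T * K_T D C 0)"
proof -
  let ?k = "K_T D C T" and ?B = "K_T D C 0"
  note k = K_T_ge_1[of T] and b = J_inf_bounds[of \<pi>]
  have B: "J_inf D R \<pi> \<le> ?k * ?B" "J_fin D R T \<pi> \<le> ?k * ?B"
    using J_sandwich(1)[of T \<pi>] k b mult_left_mono[of "J_inf D R \<pi>" ?B ?k]
      mult_right_mono[of 1 ?k ?B] by linarith+
  have "J_fin D R T \<pi> - J_inf D R \<pi> \<le> (?k - 1) * J_inf D R \<pi>"
    "J_inf D R \<pi> - J_fin D R T \<pi> \<le> (?k - 1) * J_fin D R T \<pi>"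
    using J_sandwich(1)[of T \<pi>] J_sandwich(2)[of \<pi> T] by (simp_all add: algebra_simps)
  moreover have "(?k - 1) * J_inf D R \<pi> \<le> (?k - 1) * (?k * ?B)"
    "(?k - 1) * J_fin D R T \<pi> \<le> (?k - 1) * (?k * ?B)"
    using k B by (simp_all add: mult_left_mono)
  ultimately show ?thesis by linarith
qed

end

section \<open>Continuity of the infinite-horizon functionals\<close>

lemma v_inf_tendsto:
  assumes "policy_tendsto \<eta> \<pi>" and "\<forall>s a. \<bar>R s a\<bar> \<le> C"
  shows "(\<lambda>n. v_inf D R (\<eta> n)) \<longlonglongrightarrow> v_inf D R \<pi>"
  by (rule tendsto_of_uniform_approximation[where f = "v_fin D R", OF v_fin_tendsto[OF assms(1)]
        v_truncation[OF assms(2)] truncation_tendsto_0])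

lemma J_inf_tendsto:
  assumes "policy_tendsto \<eta> \<pi>" and "\<forall>s a. \<bar>R s a\<bar> \<le> C"
  shows "(\<lambda>n. J_inf D R (\<eta> n)) \<longlonglongrightarrow> J_inf D R \<pi>"
proof (rule tendsto_of_uniform_approximation[where f = "J_fin D R", OF J_fin_tendsto[OF assms(1)] J_truncation[OF assms(2)]])
  have "(\<lambda>T. (K_T D C T - 1) * (K_T D C T * K_T D C 0)) \<longlonglongrightarrow> (1 - 1) * (1 * K_T D C 0)"
    by (intro tendsto_intros K_T_tendsto_1)
  then show "(\<lambda>T. (K_T D C T - 1) * (K_T D C T * K_T D C 0)) \<longlonglongrightarrow> 0" by simp
qed

end

section \<open>The relaxed feasible sets\<close>

locale bounded_problem = discounted +
  assumes bounded: "cost_bound D C"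
begin

lemma cost_le:
  "\<forall>s a. \<bar>objective D s a\<bar> \<le> C"
  "i \<in> {1..num1 D} \<Longrightarrow> \<forall>s a. \<bar>cost1 D i s a\<bar> \<le> C"
  "j \<in> {1..num2 D} \<Longrightarrow> \<forall>s a. \<bar>cost2 D j s a\<bar> \<le> C"
  using bounded by (auto simp: cost_bound_def)

lemma feasible_subset_feasible_plus: "feasible D \<subseteq> feasible_plus D C T"
proof
  fix \<pi> assume \<pi>: "\<pi> \<in> feasible D"
  have "v_fin D (cost1 D i) T \<pi> \<le> bound1 D i + K * \<beta> ^ T" if i: "i \<in> {1..num1 D}" for i
  proof -
    have "v_inf D (cost1 D i) \<pi> \<le> bound1 D i"
      using \<pi> i by (auto simp: feasible_def constr1_def)
    then show ?thesis
      using v_truncation[OF cost_le(2)[OF i], of T \<pi>] by linarith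
  qed
  moreover have "J_fin D (cost2 D j) T \<pi> \<le> bound2 D j * K_T D C T" if j: "j \<in> {1..num2 D}" for j
  proof -
    have "J_inf D (cost2 D j) \<pi> \<le> bound2 D j"
      using \<pi> j by (auto simp: feasible_def constr2_def)
    then have "K_T D C T * J_inf D (cost2 D j) \<pi> \<le> K_T D C T * bound2 D j"
      using K_T_ge_1[of T] by (intro mult_left_mono) auto
    then show ?thesis
      using J_sandwich(1)[OF cost_le(3)[OF j], of T \<pi>] by (simp add: mult.commute)
  qed
  ultimately show "\<pi> \<in> feasible_plus D C T"
    using \<pi> by (auto simp: feasible_def feasible_plus_def constr1_plus_def constr2_plus_def)
qed

text \<open>
  The truncation error counts twice in the infinite-horizon constraints: once in the relaxed bound,
  and once when the truncated functional is replaced by the infinite-horizon one.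
\<close>

lemma feasible_plus_bounds:
  assumes "\<pi> \<in> feasible_plus D C T"
  shows "i \<in> {1..num1 D} \<Longrightarrow> v_inf D (cost1 D i) \<pi> \<le> bound1 D i + 2 * (K * \<beta> ^ T)"
    and "j \<in> {1..num2 D} \<Longrightarrow> J_inf D (cost2 D j) \<pi> \<le> bound2 D j * (K_T D C T)\<^sup>2"
    and "k \<in> {1..num3 D} \<Longrightarrow> v_fin D (cost3 D k) (horizon3 D k) \<pi> \<le> bound3 D k"
    and "l \<in> {1..num4 D} \<Longrightarrow> J_fin D (cost4 D l) (horizon4 D l) \<pi> \<le> bound4 D l"
proof -
  show "v_inf D (cost1 D i) \<pi> \<le> bound1 D i + 2 * (K * \<beta> ^ T)" if i: "i \<in> {1..num1 D}"
  proof -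
    have "v_fin D (cost1 D i) T \<pi> \<le> bound1 D i + K * \<beta> ^ T"
      using assms i by (auto simp: feasible_plus_def constr1_plus_def)
    then show ?thesis
      using v_truncation[OF cost_le(2)[OF i], of T \<pi>] by linarith
  qed
  show "J_inf D (cost2 D j) \<pi> \<le> bound2 D j * (K_T D C T)\<^sup>2" if j: "j \<in> {1..num2 D}"
  proof -
    have "J_fin D (cost2 D j) T \<pi> \<le> bound2 D j * K_T D C T"
      using assms j by (auto simp: feasible_plus_def constr2_plus_def)
    then have "K_T D C T * J_fin D (cost2 D j) T \<pi> \<le> K_T D C T * (bound2 D j * K_T D C T)"
      using K_T_ge_1[of T] by (intro mult_left_mono) auto
    then show ?thesis
      using J_sandwich(2)[OF cost_le(3)[OF j], of \<pi> T]
      by (simp add: power2_eq_square mult_ac)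
  qed
qed (use assms in \<open>auto simp: feasible_plus_def constr3_def constr4_def\<close>)

lemma relaxed_bound1_tendsto: "(\<lambda>T. b + 2 * (K * \<beta> ^ T)) \<longlonglongrightarrow> b"
  using tendsto_add[OF tendsto_const tendsto_mult_left[OF truncation_tendsto_0, of 2], of b] by simp

lemma relaxed_bound2_tendsto: "(\<lambda>T. b * (K_T D C T)\<^sup>2) \<longlonglongrightarrow> b"
  using tendsto_mult_left[OF tendsto_power[OF K_T_tendsto_1, of 2], of b] by simp

text \<open>
  The constraint functionals are continuous and the relaxed bounds converge to the original ones,
  so non-strict inequalities pass to the limit.
\<close>

lemma limit_of_relaxed_feasible:
  assumes lim: "policy_tendsto \<eta> \<pi>" and mem: "\<And>n. \<eta> n \<in> feasible_plus D C (\<tau> n)"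
    and \<tau>: "filterlim \<tau> sequentially sequentially"
  shows "\<pi> \<in> feasible D"
proof -
  have "v_inf D (cost1 D i) \<pi> \<le> bound1 D i" if i: "i \<in> {1..num1 D}" for i
    using LIMSEQ_le[OF v_inf_tendsto[OF lim cost_le(2)[OF i]]
        filterlim_compose[OF relaxed_bound1_tendsto \<tau>]] feasible_plus_bounds(1)[OF mem i]
    by blast
  moreover have "J_inf D (cost2 D j) \<pi> \<le> bound2 D j" if j: "j \<in> {1..num2 D}" for j
    using LIMSEQ_le[OF J_inf_tendsto[OF lim cost_le(3)[OF j]]
        filterlim_compose[OF relaxed_bound2_tendsto \<tau>]] feasible_plus_bounds(2)[OF mem j]
    by blast
  moreover have "v_fin D (cost3 D k) (horizon3 D k) \<pi> \<le> bound3 D k" if "k \<in> {1..num3 D}" for k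
    using LIMSEQ_le_const2[OF v_fin_tendsto[OF lim]] feasible_plus_bounds(3)[OF mem that] by blast
  moreover have "J_fin D (cost4 D l) (horizon4 D l) \<pi> \<le> bound4 D l" if "l \<in> {1..num4 D}" for l
    using LIMSEQ_le_const2[OF J_fin_tendsto[OF lim]] feasible_plus_bounds(4)[OF mem that] by blast
  ultimately show ?thesis
    by (simp add: feasible_def constr1_def constr2_def constr3_def constr4_def)
qed

lemma eventually_eps_feasible:
  assumes "\<epsilon> > 0"
  shows "\<forall>\<^sub>F T in sequentially. \<forall>\<eta>\<in>feasible_plus D C T. eps_feasible D \<epsilon> \<eta>"
proof -
  have "\<forall>\<^sub>F T in sequentially. \<forall>i\<in>{1..num1 D}. bound1 D i + 2 * (K * \<beta> ^ T) < bound1 D i + \<epsilon>"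
    using assms by (intro eventually_ball_finite ballI order_tendstoD(2)[OF relaxed_bound1_tendsto]) auto
  moreover have "\<forall>\<^sub>F T in sequentially. \<forall>j\<in>{1..num2 D}. bound2 D j * (K_T D C T)\<^sup>2 < bound2 D j + \<epsilon>"
    using assms by (intro eventually_ball_finite ballI order_tendstoD(2)[OF relaxed_bound2_tendsto]) auto
  ultimately show ?thesis
  proof eventually_elim
    case (elim T)
    show ?case
    proof
      fix \<eta> assume "\<eta> \<in> feasible_plus D C T"
      note bounds = feasible_plus_bounds[OF this]
      show "eps_feasible D \<epsilon> \<eta>"
        unfolding eps_feasible_def
      proof (intro conjI ballI)
        fix i assume i: "i \<in> {1..num1 D}"
        show "v_inf D (cost1 D i) \<eta> \<le> bound1 D i + \<epsilon>"
          using bounds(1)[OF i] bspec[OF elim(1) i] by linarith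
      next
        fix j assume j: "j \<in> {1..num2 D}"
        show "J_inf D (cost2 D j) \<eta> \<le> bound2 D j + \<epsilon>"
          using bounds(2)[OF j] bspec[OF elim(2) j] by linarith
      next
        fix k assume k: "k \<in> {1..num3 D}"
        show "v_fin D (cost3 D k) (horizon3 D k) \<eta> \<le> bound3 D k + \<epsilon>"
          using bounds(3)[OF k] assms by linarith
      next
        fix l assume l: "l \<in> {1..num4 D}"
        show "J_fin D (cost4 D l) (horizon4 D l) \<eta> \<le> bound4 D l + \<epsilon>"
          using bounds(4)[OF l] assms by linarith
      qed
    qed
  qed
qed

lemma INF_le_J_inf: "\<pi> \<in> feasible D \<Longrightarrow> (INF \<pi>\<in>feasible D. J_inf D (objective D) \<pi>) \<le> J_inf D (objective D) \<pi>"
  by (rule cINF_lower) (use J_inf_bounds(1)[OF cost_le(1)] in \<open>auto intro!: bdd_belowI[of _ 0]\<close>)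

text \<open>
  By compactness: from relaxed feasible policies of too small value at arbitrarily large horizons, a
  convergent subsequence leads to a feasible policy whose value is below the infimum over all
  feasible policies.
\<close>

lemma eventually_relaxed_value_ge:
  assumes "\<epsilon> > 0"
  shows "\<forall>\<^sub>F T in sequentially. \<forall>\<eta>\<in>feasible_plus D C T.
    J_inf D (objective D) \<eta> > (INF \<pi>\<in>feasible D. J_inf D (objective D) \<pi>) - \<epsilon>"
proof (rule ccontr)
  let ?I = "INF \<pi>\<in>feasible D. J_inf D (objective D) \<pi>"
  assume "\<not> ?thesis"
  then have "\<forall>n. \<exists>T \<eta>. n \<le> T \<and> \<eta> \<in> feasible_plus D C T \<and> J_inf D (objective D) \<eta> \<le> ?I - \<epsilon>"
    unfolding eventually_sequentially not_ex not_all not_imp by (simp add: not_less Bex_def)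
  then obtain \<tau> \<eta> where
    choice: "\<And>n. n \<le> \<tau> n \<and> \<eta> n \<in> feasible_plus D C (\<tau> n) \<and> J_inf D (objective D) (\<eta> n) \<le> ?I - \<epsilon>"
    unfolding choice_iff by blast
  then have \<tau>: "\<And>n. n \<le> \<tau> n" and \<eta>: "\<And>n. \<eta> n \<in> feasible_plus D C (\<tau> n)"
    and le: "\<And>n. J_inf D (objective D) (\<eta> n) \<le> ?I - \<epsilon>"
    by blast+
  obtain \<pi> r where r: "strict_mono r" and lim: "policy_tendsto (\<eta> \<circ> r) \<pi>"
    by (rule policy_seq_compact)
  have "n \<le> \<tau> (r n)" for n
    using seq_suble[OF r, of n] \<tau>[of "r n"] by linarith
  then have "filterlim (\<tau> \<circ> r) sequentially sequentially"
    by (intro filterlim_at_top_mono[OF filterlim_ident]) simp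
  then have "\<pi> \<in> feasible D"
    by (rule limit_of_relaxed_feasible[OF lim, rotated]) (simp add: \<eta>)
  then have "?I \<le> J_inf D (objective D) \<pi>"
    by (rule INF_le_J_inf)
  also have "\<dots> \<le> ?I - \<epsilon>"
    using LIMSEQ_le_const2[OF J_inf_tendsto[OF lim cost_le(1)]] le by auto
  finally show False using assms by simp
qed

text \<open>
  Each feasible \<open>\<pi>\<close> competes with \<open>\<eta>\<close> in the truncated problem. The comparison at horizon \<open>T\<close> is
  transported to the infinite horizon by the sandwich estimate, applied once to \<open>\<eta>\<close> and once to \<open>\<pi>\<close>.
\<close>

lemma minimizer_value_le:
  assumes min: "is_arg_min (J_fin D (objective D) T) (\<lambda>\<pi>. \<pi> \<in> feasible_plus D C T) \<eta>"
    and ne: "feasible D \<noteq> {}"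
  shows "J_inf D (objective D) \<eta> \<le> (INF \<pi>\<in>feasible D. J_inf D (objective D) \<pi>) * (K_T D C T)\<^sup>2"
proof -
  let ?k = "K_T D C T" and ?R = "objective D"
  have k: "?k > 0" using K_T_ge_1[of T] by simp
  have "J_inf D ?R \<eta> / ?k\<^sup>2 \<le> J_inf D ?R \<pi>" if \<pi>: "\<pi> \<in> feasible D" for \<pi>
  proof -
    have "J_inf D ?R \<eta> \<le> ?k * J_fin D ?R T \<eta>"
      by (rule J_sandwich(2)[OF cost_le(1)])
    also have "J_fin D ?R T \<eta> \<le> J_fin D ?R T \<pi>"
      using min \<pi> feasible_subset_feasible_plus[of T] by (auto simp: is_arg_min_linorder)
    also have "\<dots> \<le> ?k * J_inf D ?R \<pi>"
      by (rule J_sandwich(1)[OF cost_le(1)])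
    finally show ?thesis
      using k by (simp add: field_simps power2_eq_square)
  qed
  then have "J_inf D ?R \<eta> / ?k\<^sup>2 \<le> (INF \<pi>\<in>feasible D. J_inf D ?R \<pi>)"
    by (intro cINF_greatest ne)
  then show ?thesis using k by (simp add: field_simps)
qed

end

theorem theorem3p4:
  fixes D :: "('s::finite, 'a::finite) problem" and C \<epsilon> :: real
  assumes "0 < discount D" and "discount D < 1" and "risk D \<noteq> 0"
    and "num1 D \<noteq> 0 \<or> num2 D \<noteq> 0 \<or> num3 D \<noteq> 0 \<or> num4 D \<noteq> 0"
    and "\<forall>k\<in>{1..num3 D}. horizon3 D k \<ge> 1"
    and "\<forall>l\<in>{1..num4 D}. horizon4 D l \<ge> 1"
    and "C > 0" and "cost_bound D C"
    and "feasible D \<noteq> {}"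
    and "\<epsilon> > 0"
  shows "\<exists>T0::nat. T0 > 0 \<and> (\<forall>T\<ge>T0. \<forall>\<eta>.
    is_arg_min (J_fin D (objective D) T) (\<lambda>\<pi>. \<pi> \<in> feasible_plus D C T) \<eta> \<longrightarrow>
      eps_feasible D \<epsilon> \<eta> \<and>
      \<bar>J_inf D (objective D) \<eta> - (INF \<pi>\<in>feasible D. J_inf D (objective D) \<pi>)\<bar> < \<epsilon>)"
proof -
  let ?I = "INF \<pi>\<in>feasible D. J_inf D (objective D) \<pi>"
  interpret bounded_problem D C
    using assms by unfold_locales auto
  have "\<forall>\<^sub>F T in sequentially. ?I * (K_T D C T)\<^sup>2 < ?I + \<epsilon>"
    using assms by (intro order_tendstoD(2)[OF relaxed_bound2_tendsto]) auto
  with eventually_eps_feasible[OF \<open>\<epsilon> > 0\<close>] eventually_relaxed_value_ge[OF \<open>\<epsilon> > 0\<close>]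
    eventually_gt_at_top[of 0]
  have "\<forall>\<^sub>F T in sequentially. T > 0 \<and> (\<forall>\<eta>.
    is_arg_min (J_fin D (objective D) T) (\<lambda>\<pi>. \<pi> \<in> feasible_plus D C T) \<eta> \<longrightarrow>
      eps_feasible D \<epsilon> \<eta> \<and> \<bar>J_inf D (objective D) \<eta> - ?I\<bar> < \<epsilon>)"
  proof eventually_elim
    case (elim T)
    have "eps_feasible D \<epsilon> \<eta> \<and> \<bar>J_inf D (objective D) \<eta> - ?I\<bar> < \<epsilon>"
      if min: "is_arg_min (J_fin D (objective D) T) (\<lambda>\<pi>. \<pi> \<in> feasible_plus D C T) \<eta>" for \<eta>
    proof -
      have "\<eta> \<in> feasible_plus D C T" using min by (simp add: is_arg_min_def)
      then have "eps_feasible D \<epsilon> \<eta>" "J_inf D (objective D) \<eta> > ?I - \<epsilon>"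
        using elim by auto
      moreover have "J_inf D (objective D) \<eta> < ?I + \<epsilon>"
        using minimizer_value_le[OF min \<open>feasible D \<noteq> {}\<close>] elim by linarith
      ultimately show ?thesis by linarith
    qed
    with elim show ?case by blast
  qed
  then obtain T0 where T0: "\<forall>T\<ge>T0. T > 0 \<and> (\<forall>\<eta>.
    is_arg_min (J_fin D (objective D) T) (\<lambda>\<pi>. \<pi> \<in> feasible_plus D C T) \<eta> \<longrightarrow>
      eps_feasible D \<epsilon> \<eta> \<and> \<bar>J_inf D (objective D) \<eta> - ?I\<bar> < \<epsilon>)"
    unfolding eventually_sequentially by blast
  then have "T0 > 0" by blast
  with T0 show ?thesis by blast
qed

end
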